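(* For every integer $r\ge 2$, $\frac{2e^{-1}}{r^2+r} \leq \pi_r \leq \frac{2e^{-1}}{r^2-r}$, where $\pi_r = \max_{n \ge 1} n^{-r-1}\, r!\, \binom{n}{r}$.
   Context: The maximum defining $\pi_r$ is over positive integers $n$. *)

theory Defs
  imports Complex_Main
begin

definition pi_term :: "nat \<Rightarrow> nat \<Rightarrow> real" where
  "pi_term r n = real n powi (- int r - 1) * fact r * real (n choose r)"

text \<open>
  The maximum ranges over an infinite set, so \<open>Max\<close>, which is meant for finite sets, does not
  apply. \<open>GREATEST\<close> denotes the largest value attained; it is unspecified if no
  maximum is attained.
\<close>

definition pi_max :: "nat \<Rightarrow> real" where
  "pi_max r = (GREATEST x. \<exists>n\<ge>1. x = pi_term r n)"

end

(* With x = 1/n the n-th term is x * (1 - 0 x) ... (1 - (r-1) x). Since 1 - t <= exp (-t), it is at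
   most x * exp (-c x) with c = r (r - 1) / 2, which is at most 1 / (e c). For the lower bound take
   n = r (r + 1) / 2: from 1 + y <= exp y at y = i / (n - i) the product is at least
   exp (- SUM i / (n - i)), and this sum is at most c / (n - r + 1) <= 1. *)
theory Submission
  imports Defs
begin

text \<open>\<open>fact r * (n choose r)\<close> is a falling factorial; taking \<open>n\<close> out
  of each of its \<open>r\<close> factors leaves one \<open>1 / n\<close> of the power. For
  \<open>n < r\<close> both sides vanish, because of the factor at \<open>i = n\<close>.\<close>

lemma pi_term_eq_prod:
  assumes "n \<ge> 1"
  shows "pi_term r n = (\<Prod>i<r. 1 - real i / real n) / real n"
proof -
  have "fact r * real (n choose r) = (\<Prod>i<r. real n - real i)"
    by (simp add: binomial_gbinomial gbinomial_mult_fact atLeast0LessThan)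
  also have "\<dots> = (\<Prod>i<r. real n * (1 - real i / real n))"
    using assms by (intro prod.cong) (auto simp: field_simps)
  also have "\<dots> = real n ^ r * (\<Prod>i<r. 1 - real i / real n)"
    by (simp add: prod.distrib)
  finally show ?thesis
    using assms by (simp add: pi_term_def power_int_diff power_int_minus field_simps)
qed

lemma sum_real_lessThan: "(\<Sum>i<r. real i) = real r * (real r - 1) / 2"
  by (induction r) (auto simp: field_simps)

text \<open>The left side peaks at \<open>x = 1 / c\<close>, so \<open>1 + y \<le> exp y\<close> is
  applied at \<open>y = c * x - 1\<close>, where equality holds at that peak.\<close>

lemma mult_exp_minus_le:
  fixes c x :: real
  assumes "c > 0"
  shows "x * exp (- (c * x)) \<le> exp (-1) / c"
proof -
  have "c * x \<le> exp (c * x - 1)"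
    using exp_ge_add_one_self[of "c * x - 1"] by simp
  then have "c * x * exp (- (c * x)) \<le> exp (c * x - 1) * exp (- (c * x))"
    by (intro mult_right_mono) auto
  also have "\<dots> = exp (-1)"
    by (simp flip: exp_add)
  finally show ?thesis
    using assms by (simp add: field_simps)
qed

lemma pi_term_le:
  assumes "r \<ge> 2" "n \<ge> 1"
  shows "pi_term r n \<le> 2 * exp (-1) / (real r ^ 2 - real r)"
\<comment> \<open>Bounding a product factor by factor needs nonnegative factors; for
  \<open>n < r\<close> some may be negative, but then the term is 0.\<close>
proof (cases "n < r")
  case True
  then show ?thesis
    using assms by (simp add: pi_term_def binomial_eq_0 power2_eq_square)
next
  case False
  define c where "c = real r * (real r - 1) / 2"
  have "c > 0"
    using assms by (simp add: c_def)
  have "(\<Prod>i<r. 1 - real i / real n) \<le> (\<Prod>i<r. exp (- (real i / real n)))"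
  proof (intro prod_mono conjI)
    fix i assume "i \<in> {..<r}"
    then show "0 \<le> 1 - real i / real n"
      using False assms by simp
    show "1 - real i / real n \<le> exp (- (real i / real n))"
      using exp_ge_add_one_self[of "- (real i / real n)"] by simp
  qed
  also have "\<dots> = exp (- (c * (1 / real n)))"
    by (simp add: c_def sum_negf flip: exp_sum sum_divide_distrib sum_real_lessThan)
  finally have "pi_term r n \<le> 1 / real n * exp (- (c * (1 / real n)))"
    using assms by (simp add: pi_term_eq_prod divide_right_mono)
  also have "\<dots> \<le> exp (-1) / c"
    using \<open>c > 0\<close> by (rule mult_exp_minus_le)
  also have "\<dots> = 2 * exp (-1) / (real r ^ 2 - real r)"
    by (simp add: c_def power2_eq_square algebra_simps)
  finally show ?thesis .
qed

text \<open>Forces the terms to tend to 0, which is what makes the supremum over all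
  \<open>n\<close> a maximum.\<close>

lemma pi_term_le_inverse:
  assumes "n \<ge> 1"
  shows "pi_term r n \<le> 1 / real n"
proof (cases "n < r")
  case True
  then show ?thesis by (simp add: pi_term_def binomial_eq_0)
next
  case False
  then have "(\<Prod>i<r. 1 - real i / real n) \<le> 1"
    using assms by (intro prod_le_1) auto
  then show ?thesis
    using assms by (simp add: pi_term_eq_prod divide_right_mono)
qed

lemma pi_term_triangular_ge:
  assumes "r \<ge> 2"
  shows "2 * exp (-1) / (real r ^ 2 + real r) \<le> pi_term r (r * (r + 1) div 2)"
proof -
  define n where "n = r * (r + 1) div 2"
  \<comment> \<open>The division by 2 is exact since \<open>r * (r + 1)\<close> is even. With this
    \<open>n\<close>, \<open>exp (-1) / n\<close> is exactly the claimed bound.\<close>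
  have n: "real n = real r * (real r + 1) / 2"
    using real_of_nat_div[of 2 "r * (r + 1)"] by (simp add: n_def algebra_simps)
  have rr: "real r * (real r - 1) \<ge> 2"
    using mult_mono[of 2 "real r" 1 "real r - 1"] assms by simp
  \<comment> \<open>The least of the denominators \<open>n - i\<close>, taken at
    \<open>i = r - 1\<close>.\<close>
  define d where "d = real n - real r + 1"
  have d: "d = real r * (real r - 1) / 2 + 1"
    by (simp add: d_def n field_simps)
  have "d > 0"
    using rr d by simp
  have "n \<ge> 1"
    using rr d \<open>r \<ge> 2\<close> by (simp add: d_def)
  \<comment> \<open>The numerators add up to \<open>r * (r - 1) / 2\<close>, which is
    \<open>d - 1\<close>.\<close>
  have "(\<Sum>i<r. real i / d) \<le> 1"
    using \<open>d > 0\<close> by (simp add: sum_real_lessThan d flip: sum_divide_distrib)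
  then have "exp (-1) \<le> exp (- (\<Sum>i<r. real i / d))"
    by simp
  also have "\<dots> = (\<Prod>i<r. exp (- (real i / d)))"
    by (simp add: exp_sum flip: sum_negf)
  also have "\<dots> \<le> (\<Prod>i<r. 1 - real i / real n)"
  proof (intro prod_mono conjI)
    fix i assume "i \<in> {..<r}"
    then have i: "d \<le> real n - real i"
      by (auto simp: d_def)
    \<comment> \<open>Bounding the reciprocal of the factor from above turns
      \<open>1 + y \<le> exp y\<close> into a lower bound for the factor.\<close>
    have "real n / (real n - real i) = 1 + real i / (real n - real i)"
      using i \<open>d > 0\<close> by (simp add: field_simps)
    also have "\<dots> \<le> exp (real i / (real n - real i))"
      by (rule exp_ge_add_one_self)
    also have "\<dots> \<le> exp (real i / d)"
      using i \<open>d > 0\<close> by (simp add: frac_le)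
    finally show "exp (- (real i / d)) \<le> 1 - real i / real n"
      using i \<open>d > 0\<close> \<open>n \<ge> 1\<close> by (simp add: exp_minus field_simps)
  qed auto
  finally have "exp (-1) / real n \<le> pi_term r n"
    using \<open>n \<ge> 1\<close> by (simp add: pi_term_eq_prod divide_right_mono)
  moreover have "exp (-1) / real n = 2 * exp (-1) / (real r ^ 2 + real r)"
    by (simp add: n power2_eq_square algebra_simps)
  ultimately show ?thesis
    by (simp add: n_def)
qed

text \<open>Gives \<open>GREATEST\<close> its meaning: one term is positive and all but finitely
  many lie below it, so a maximum over a finite range is global.\<close>

lemma pi_max_attained:
  assumes "r \<ge> 2"
  obtains m where "m \<ge> 1" "pi_max r = pi_term r m" "\<And>n. n \<ge> 1 \<Longrightarrow> pi_term r n \<le> pi_term r m"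
proof -
  define k where "k = r * (r + 1) div 2"
  have "k \<ge> 1"
    using assms div_le_mono[of 2 "r * (r + 1)" 2] by (simp add: k_def)
  have "0 < 2 * exp (-1) / (real r ^ 2 + real r)"
    using assms by (simp add: add_pos_pos)
  then have pos: "pi_term r k > 0"
    using pi_term_triangular_ge[OF assms] by (simp add: k_def)
  obtain N where N: "inverse (real (Suc N)) < pi_term r k"
    using reals_Archimedean[OF pos] by auto
  have small: "pi_term r n < pi_term r k" if "n > N" for n
  proof -
    have "pi_term r n \<le> 1 / real n"
      using that by (intro pi_term_le_inverse) simp
    also have "\<dots> \<le> inverse (real (Suc N))"
      using that by (simp add: field_simps)
    finally show ?thesis
      using N by simp
  qed
  \<comment> \<open>The range must contain \<open>k\<close> too, since terms beyond \<open>N\<close>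
    are compared with the one at \<open>k\<close>.\<close>
  let ?A = "{1..max k N}"
  have "finite (pi_term r ` ?A)" "pi_term r ` ?A \<noteq> {}"
    using \<open>k \<ge> 1\<close> by auto
  from Max_in[OF this] obtain m where m: "m \<in> ?A" "Max (pi_term r ` ?A) = pi_term r m"
    by auto
  have le: "pi_term r n \<le> pi_term r m" if "n \<in> ?A" for n
    using that by (simp flip: m(2))
  have max: "pi_term r n \<le> pi_term r m" if "n \<ge> 1" for n
  proof (cases "n \<le> N")
    case True
    then show ?thesis using le[of n] that by simp
  next
    case False
    then show ?thesis using small[of n] le[of k] \<open>k \<ge> 1\<close> by simp
  qed
  have "pi_max r = pi_term r m"
    unfolding pi_max_def using m(1) max by (intro Greatest_equality) auto
  with m(1) max show ?thesis
    by (intro that[of m]) auto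
qed

theorem theorem4:
  fixes r :: nat
  assumes "r \<ge> 2"
  shows "2 * exp (-1) / (real r ^ 2 + real r) \<le> pi_max r
       \<and> pi_max r \<le> 2 * exp (-1) / (real r ^ 2 - real r)"
proof -
  obtain m where m: "m \<ge> 1" "pi_max r = pi_term r m"
      "\<And>n. n \<ge> 1 \<Longrightarrow> pi_term r n \<le> pi_term r m"
    using pi_max_attained[OF assms] by blast
  have "r * (r + 1) div 2 \<ge> 1"
    using assms div_le_mono[of 2 "r * (r + 1)" 2] by simp
  from m(3)[OF this] show ?thesis
    using pi_term_triangular_ge[OF assms] pi_term_le[OF assms m(1)] m(2) by simp
qed

end
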